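(* For all integers $k\geq 1$ and $d\geq 4$, the graph $DDPG_{k,d}$ has $k$ totally disjoint diametral paths of length $d$.
   Context: All graphs are finite, simple and connected. The length of a path is its number of edges. The diameter of $G$ is the greatest distance between any pair of vertices; a diametral path is a shortest path connecting two vertices whose distance equals the diameter (so the existence of a diametral path of length $d$ means the diameter is $d$). Two paths are totally disjoint if they have no vertex in common, including their end vertices; a set of paths is totally disjoint if every two of its members are. For $d\ge 4$, $DDPG_{k,d}$ consists of $k$ vertex-disjoint paths $p_1,\dots,p_k$ of length $d$, where $p_i$ has vertices $p_{i,0},\dots,p_{i,d}$ connected by edges in that order, together with the following edges: letting $h=\lfloor d/2\rfloor$ and $h'=\lceil d/2\rceil$, each path $p_i$ with $1<i\le k$ is connected to $p_1$ by the two edges $(p_{1,h},p_{i,h-1})$ and $(p_{1,h'},p_{i,h'+1})$. *)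

theory Defs
  imports "Graph_Theory.Graph_Theory"
begin

text \<open>
  A finite simple graph is a \<^locale>\<open>pair_graph\<close>: every undirected edge is represented
  by its two opposite arcs. Paths are vertex paths (\<^const>\<open>vpath\<close>), and their length
  \<^const>\<open>vwalk_length\<close> is the number of edges.
\<close>

text \<open>
  The distance is the shortest-path weight for unit weights. It takes the value \<open>\<infinity>\<close> between
  vertices in different components, so a finite diameter entails connectedness.
\<close>

definition gdist :: "('a, 'b) pre_digraph \<Rightarrow> 'a \<Rightarrow> 'a \<Rightarrow> ereal" where
  "gdist G u v = wf_digraph.\<mu> G (\<lambda>_. 1) u v"

definition diameter :: "('a, 'b) pre_digraph \<Rightarrow> ereal" where
  "diameter G = (SUP u\<in>verts G. SUP v\<in>verts G. gdist G u v)"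

definition diametral_path :: "('a, 'b) pre_digraph \<Rightarrow> 'a vwalk \<Rightarrow> bool" where
  "diametral_path G p \<longleftrightarrow>
     vpath p G \<and>
     ereal (real (vwalk_length p)) = gdist G (hd p) (last p) \<and>
     gdist G (hd p) (last p) = diameter G"

definition totally_disjoint :: "'a vwalk \<Rightarrow> 'a vwalk \<Rightarrow> bool" where
  "totally_disjoint p q \<longleftrightarrow> set p \<inter> set q = {}"

text \<open>
  The pair \<open>(i, j)\<close> stands for the vertex \<open>p\<^sub>i\<^sub>,\<^sub>j\<close>. In \<open>DDPG_edges\<close> each edge is listed in
  one direction only. Here \<open>d div 2 = \<lfloor>d/2\<rfloor>\<close> and \<open>(d + 1) div 2 = \<lceil>d/2\<rceil>\<close>; for \<open>d \<ge> 4\<close>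
  the subtraction does not truncate.
\<close>

definition DDPG_edges :: "nat \<Rightarrow> nat \<Rightarrow> (nat \<times> nat) rel" where
  "DDPG_edges k d =
     (let h = d div 2; h' = (d + 1) div 2 in
        {((i, j), (i, j + 1)) | i j. 1 \<le> i \<and> i \<le> k \<and> j < d} \<union>
        {((1, h), (i, h - 1)) | i. 1 < i \<and> i \<le> k} \<union>
        {((1, h'), (i, h' + 1)) | i. 1 < i \<and> i \<le> k})"

definition DDPG :: "nat \<Rightarrow> nat \<Rightarrow> (nat \<times> nat) pair_pre_digraph" where
  "DDPG k d =
     \<lparr>pverts = {1..k} \<times> {0..d}, parcs = DDPG_edges k d \<union> (DDPG_edges k d)\<inverse>\<rparr>"

lemma pair_graph_DDPG:
  assumes "d \<ge> 4"
  shows "pair_graph (DDPG k d)"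
proof -
  let ?V = "{1..k} \<times> {0..d}"
  have sub: "DDPG_edges k d \<subseteq> ?V \<times> ?V"
    using assms by (auto simp: DDPG_edges_def Let_def)
  have irr: "(u, u) \<notin> DDPG_edges k d" for u
    by (auto simp: DDPG_edges_def Let_def)
  have sub': "parcs (DDPG k d) \<subseteq> ?V \<times> ?V"
    using sub by (auto simp: DDPG_def)
  have fin: "finite (parcs (DDPG k d))"
    by (rule finite_subset[OF sub']) simp
  show ?thesis
  proof
    show "fst e \<in> pverts (DDPG k d)" "snd e \<in> pverts (DDPG k d)"
      if "e \<in> parcs (DDPG k d)" for e
      using that sub' by (auto simp: DDPG_def)
    show "finite (pverts (DDPG k d))" by (simp add: DDPG_def)
    show "finite (parcs (DDPG k d))" by (fact fin)
    show "fst e \<noteq> snd e" if "e \<in> parcs (DDPG k d)" for e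
      using that irr by (cases e) (auto simp: DDPG_def)
    show "symmetric (with_proj (DDPG k d))"
      by (auto simp: symmetric_def DDPG_def intro!: symI)
  qed
qed

end

theory Submission
  imports Defs
begin

text \<open>
  Every edge of the graph changes the column \<open>j\<close> of a vertex \<open>p\<^sub>i\<^sub>,\<^sub>j\<close> by exactly one, so the ends
  of each \<open>p\<^sub>i\<close> are at distance at least \<open>d\<close>. Conversely, every vertex with \<open>j \<le> h\<close> is within
  distance \<open>h\<close> of \<open>p\<^sub>1\<^sub>,\<^sub>h\<close>, every other vertex is within distance \<open>d - h' = h\<close> of \<open>p\<^sub>1\<^sub>,\<^sub>h\<^sub>'\<close>, and
  these two centres are at distance \<open>h' - h\<close>; hence no distance exceeds \<open>h + (h' - h) + h = d\<close>.
  So the paths \<open>p\<^sub>i\<close> themselves are diametral.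
\<close>

section \<open>Distances for unit weights in a digraph\<close>

context wf_digraph
begin

lemma awalk_cost_unit: "awalk_cost (\<lambda>_. 1) p = real (length p)"
  by (induction p) auto

lemma gdist_eq_INF: "gdist G u v = (INF p\<in>{p. awalk u p v}. ereal (real (length p)))"
  by (simp add: gdist_def \<mu>_def awalk_cost_unit)

text \<open>Lengths are integers: passing to the strict bound \<open>Suc n\<close> lets the infimum
  supply an actual walk of length at most \<open>n\<close>. Distance bounds can then be combined by
  combining walks.\<close>

lemma gdist_le_iff:
  "gdist G u v \<le> ereal (real n) \<longleftrightarrow> (\<exists>p. awalk u p v \<and> length p \<le> n)"
proof
  assume "gdist G u v \<le> ereal (real n)"
  also have "ereal (real n) < ereal (real (Suc n))"
    by simp
  finally obtain p where "awalk u p v" "length p < Suc n"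
    unfolding gdist_eq_INF INF_less_iff by auto
  then show "\<exists>p. awalk u p v \<and> length p \<le> n"
    by auto
next
  assume "\<exists>p. awalk u p v \<and> length p \<le> n"
  then show "gdist G u v \<le> ereal (real n)"
    unfolding gdist_eq_INF by (auto intro: INF_lower2)
qed

lemma gdist_le_trans:
  assumes "gdist G u v \<le> ereal (real m)" "gdist G v w \<le> ereal (real n)"
  shows "gdist G u w \<le> ereal (real (m + n))"
proof -
  obtain p q where "awalk u p v" "length p \<le> m" "awalk v q w" "length q \<le> n"
    using assms unfolding gdist_le_iff by blast
  then have "awalk u (p @ q) w" "length (p @ q) \<le> m + n"
    by (auto intro: awalk_appendI)
  then show ?thesis
    unfolding gdist_le_iff by blast
qed

lemma gdist_le_mono:
  assumes "gdist G u v \<le> ereal (real m)" "m \<le> n"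
  shows "gdist G u v \<le> ereal (real n)"
  using assms order_trans by fastforce

lemma gdist_refl_le: "u \<in> verts G \<Longrightarrow> gdist G u u \<le> ereal (real n)"
  unfolding gdist_le_iff by (auto intro!: exI[of _ "[]"] simp: awalk_Nil_iff)

lemma gdist_arc_le:
  assumes "(u, v) \<in> arcs_ends G"
  shows "gdist G u v \<le> ereal (real 1)"
proof -
  obtain e where "e \<in> arcs G" "tail G e = u" "head G e = v"
    using assms by auto
  then have "awalk u [e] v"
    using arc_implies_awalk by blast
  then show ?thesis
    unfolding gdist_le_iff by (intro exI[of _ "[e]"]) simp
qed

text \<open>Summing the increments of \<open>f\<close> along a walk bounds its total rise by the
  number of arcs. This serves for the lower bound on the distance between the ends of a row.\<close>

lemma gdist_ge_potential:
  fixes f :: "'a \<Rightarrow> real"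
  assumes "\<And>e. e \<in> arcs G \<Longrightarrow> f (head G e) \<le> f (tail G e) + 1"
  shows "ereal (f v - f u) \<le> gdist G u v"
proof -
  have "f v \<le> f u + real (length p)" if "awalk u p v" for p
    using that
  proof (induction p arbitrary: u)
    case (Cons e p)
    then have "f v \<le> f (head G e) + real (length p)" "e \<in> arcs G" "u = tail G e"
      by (auto simp: awalk_Cons_iff)
    then show ?case
      using assms[of e] by simp
  qed (simp add: awalk_Nil_iff)
  then show ?thesis
    unfolding gdist_eq_INF by (force intro: INF_greatest)
qed

end

text \<open>Reversing a walk keeps its length. The row and centre bounds below are each proved in
  one direction only and turned around by this.\<close>

lemma (in pair_sym_digraph) gdist_le_sym:
  "gdist G u v \<le> ereal (real n) \<Longrightarrow> gdist G v u \<le> ereal (real n)"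
proof -
  have "length (rev_path p) = length p" for p :: "('a \<times> 'a) list"
    by (induction p) auto
  then show "gdist G u v \<le> ereal (real n) \<Longrightarrow> gdist G v u \<le> ereal (real n)"
    unfolding gdist_le_iff by (metis awalk_rev_path)
qed

lemma vwalk_map_upt:
  assumes "\<And>j. j \<le> n \<Longrightarrow> f j \<in> verts G"
    and "\<And>j. j < n \<Longrightarrow> (f j, f (Suc j)) \<in> arcs_ends G"
  shows "vwalk (map f [0..<Suc n]) G"
  using assms
proof (induction n)
  case 0
  then show ?case by (simp add: vwalk_def)
next
  case (Suc n)
  then have "vwalk (map f [0..<Suc n]) G"
    by simp
  moreover have "vwalk_arcs (map f [0..<Suc (Suc n)]) =
      vwalk_arcs (map f [0..<Suc n]) @ [(f n, f (Suc n))]"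
    using vwalk_arcs_append[of "map f [0..<Suc n]" "[f (Suc n)]"] by simp
  ultimately show ?case
    using Suc.prems by (auto simp: vwalk_def)
qed

section \<open>Distances and diametral paths in \<open>DDPG k d\<close>\<close>

context
  fixes k d h h' :: nat
  assumes d: "d \<ge> 4"
  defines "h \<equiv> d div 2" and "h' \<equiv> (d + 1) div 2"
begin

interpretation pair_graph "DDPG k d"
  using pair_graph_DDPG[OF d] .

lemma DDPG_gdist_row:
  assumes "1 \<le> i" "i \<le> k" "j \<le> j'" "j' \<le> d"
  shows "gdist (DDPG k d) (i, j) (i, j') \<le> ereal (real (j' - j))"
  using assms(3,4)
proof (induction j' rule: dec_induct)
  case base
  then show ?case
    using assms gdist_refl_le[of "(i, j)" 0] by (simp add: DDPG_def)
next
  case (step m)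
  have "((i, m), (i, Suc m)) \<in> parcs (DDPG k d)"
    using step assms by (auto simp: DDPG_def DDPG_edges_def Let_def)
  then have "gdist (DDPG k d) (i, m) (i, Suc m) \<le> ereal (real 1)"
    by (intro gdist_arc_le) simp
  moreover have "gdist (DDPG k d) (i, j) (i, m) \<le> ereal (real (m - j))"
    using step by simp
  ultimately have "gdist (DDPG k d) (i, j) (i, Suc m) \<le> ereal (real (m - j + 1))"
    by (rule gdist_le_trans[rotated])
  then show ?case
    using step by (simp add: Suc_diff_le)
qed

lemma DDPG_gdist_left_centre:
  assumes "1 \<le> i" "i \<le> k" "j \<le> h"
  shows "gdist (DDPG k d) (i, j) (1, h) \<le> ereal (real h)"
proof (cases "i = 1")
  case True
  then show ?thesis
    using gdist_le_mono[OF DDPG_gdist_row[of i j h], of h] assms d by (simp add: h_def)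
next
  case False
  then have "((i, h - 1), (1, h)) \<in> parcs (DDPG k d)"
    using assms by (auto simp: DDPG_def DDPG_edges_def Let_def h_def)
  then have arc: "gdist (DDPG k d) (i, h - 1) (1, h) \<le> ereal (real 1)"
    by (intro gdist_arc_le) simp
  have "gdist (DDPG k d) (i, j) (i, h - 1) \<le> ereal (real (h - 1))"
  \<comment> \<open>The connecting edge leaves from column \<open>h - 1\<close>, so a vertex in
    column \<open>h\<close> must first step back. That step fits into \<open>h - 1\<close> because
    \<open>d \<ge> 4\<close> gives \<open>h \<ge> 2\<close>.\<close>
  proof (cases "j = h")
    case True
    then show ?thesis
      using gdist_le_mono[OF gdist_le_sym[OF DDPG_gdist_row[of i "h - 1" h]], of "h - 1"] assms d
      by (simp add: h_def)
  next
    case False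
    then show ?thesis
      using gdist_le_mono[OF DDPG_gdist_row[of i j "h - 1"], of "h - 1"] assms d
      by (simp add: h_def)
  qed
  from gdist_le_trans[OF this arc] show ?thesis
    using d by (simp add: h_def)
qed

lemma DDPG_gdist_right_centre:
  assumes "1 \<le> i" "i \<le> k" "h' \<le> j" "j \<le> d"
  shows "gdist (DDPG k d) (1, h') (i, j) \<le> ereal (real h)"
proof (cases "i = 1")
  case True
  then show ?thesis
    using gdist_le_mono[OF DDPG_gdist_row[of i h' j], of h] assms d
    by (simp add: h_def h'_def)
next
  case False
  then have "((1, h'), (i, h' + 1)) \<in> parcs (DDPG k d)"
    using assms by (auto simp: DDPG_def DDPG_edges_def Let_def h'_def)
  then have arc: "gdist (DDPG k d) (1, h') (i, h' + 1) \<le> ereal (real 1)"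
    by (intro gdist_arc_le) simp
  have "gdist (DDPG k d) (i, h' + 1) (i, j) \<le> ereal (real (h - 1))"
  \<comment> \<open>Mirror image: column \<open>h'\<close> lies one step short of the entry column
    \<open>h' + 1\<close>, and from there the far end \<open>d\<close> is \<open>h - 1\<close> steps
    away.\<close>
  proof (cases "j = h'")
    case True
    then show ?thesis
      using gdist_le_mono[OF gdist_le_sym[OF DDPG_gdist_row[of i h' "h' + 1"]], of "h - 1"] assms d
      by (simp add: h_def h'_def)
  next
    case False
    then show ?thesis
      using gdist_le_mono[OF DDPG_gdist_row[of i "h' + 1" j], of "h - 1"] assms d
      by (simp add: h_def h'_def)
  qed
  from gdist_le_trans[OF arc this] show ?thesis
    using d by (simp add: h_def)
qed

lemma DDPG_gdist_le:
  assumes "u \<in> pverts (DDPG k d)" "v \<in> pverts (DDPG k d)"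
  shows "gdist (DDPG k d) u v \<le> ereal (real d)"
proof -
  obtain i j i' j' where uv: "u = (i, j)" "v = (i', j')"
    and i: "1 \<le> i" "i \<le> k" "j \<le> d" and i': "1 \<le> i'" "i' \<le> k" "j' \<le> d"
    using assms by (auto simp: DDPG_def)
  have le: "h + h \<le> d" "h + (h' - h) + h \<le> d"
    by (auto simp: h_def h'_def)
  have mid: "gdist (DDPG k d) (1, h) (1, h') \<le> ereal (real (h' - h))"
    using i by (intro DDPG_gdist_row) (auto simp: h_def h'_def)
  \<comment> \<open>Stated for arbitrary vertices on opposite sides, since it is applied with
    \<open>u\<close> on the left and again with \<open>v\<close> on the left.\<close>
  have cross: "gdist (DDPG k d) (a, b) (a', b') \<le> ereal (real d)"
    if "1 \<le> a" "a \<le> k" "b \<le> h" "1 \<le> a'" "a' \<le> k" "h' \<le> b'" "b' \<le> d" for a b a' b'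
    using that le(2) mid
    by (intro gdist_le_mono[OF gdist_le_trans[OF gdist_le_trans[OF
          DDPG_gdist_left_centre mid] DDPG_gdist_right_centre]]) auto
  \<comment> \<open>No column lies strictly between \<open>h\<close> and \<open>h'\<close>, as they
    differ by at most 1; for even \<open>d\<close> the middle column is on both sides.\<close>
  have sides: "j \<le> h \<or> h' \<le> j" "j' \<le> h \<or> h' \<le> j'"
    by (auto simp: h_def h'_def)
  then consider "j \<le> h" "j' \<le> h" | "h' \<le> j" "h' \<le> j'" | "j \<le> h" "h' \<le> j'" | "h' \<le> j" "j' \<le> h"
    by blast
  then show ?thesis
  proof cases
    case 1
    then show ?thesis
      using gdist_le_mono[OF gdist_le_trans[OF DDPG_gdist_left_centre
          gdist_le_sym[OF DDPG_gdist_left_centre]] le(1)] uv i i' by auto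
  next
    case 2
    then show ?thesis
      using gdist_le_mono[OF gdist_le_trans[OF gdist_le_sym[OF DDPG_gdist_right_centre]
          DDPG_gdist_right_centre] le(1)] uv i i' by auto
  next
    case 3
    then show ?thesis
      using cross[of i j i' j'] uv i i' by simp
  next
    case 4
    then show ?thesis
      using gdist_le_sym[OF cross[of i' j' i j]] uv i i' by simp
  qed
qed

lemma DDPG_gdist_ends:
  assumes "1 \<le> i" "i \<le> k"
  shows "gdist (DDPG k d) (i, 0) (i, d) = ereal (real d)"
proof (rule antisym)
  show "gdist (DDPG k d) (i, 0) (i, d) \<le> ereal (real d)"
    using assms by (intro DDPG_gdist_le) (auto simp: DDPG_def)
  \<comment> \<open>The potential is the column index; both orientations of every edge are
    checked.\<close>
  have "real (snd (snd e)) \<le> real (snd (fst e)) + 1" if "e \<in> parcs (DDPG k d)" for e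
    using that by (auto simp: DDPG_def DDPG_edges_def Let_def)
  then show "ereal (real d) \<le> gdist (DDPG k d) (i, 0) (i, d)"
    using gdist_ge_potential[of "\<lambda>v. real (snd v)" "(i, d)" "(i, 0)"] by simp
qed

lemma DDPG_diameter:
  assumes "k \<ge> 1"
  shows "diameter (DDPG k d) = ereal (real d)"
proof (rule antisym)
  show "diameter (DDPG k d) \<le> ereal (real d)"
    unfolding diameter_def by (auto intro!: SUP_least DDPG_gdist_le)
  \<comment> \<open>Row 1 serves as witness, being present for every
    \<open>k \<ge> 1\<close>.\<close>
  have "gdist (DDPG k d) (1, 0) (1, d) \<le> diameter (DDPG k d)"
    unfolding diameter_def using assms
    by (intro SUP_upper2[of "(1, 0)"] SUP_upper) (auto simp: DDPG_def)
  then show "ereal (real d) \<le> diameter (DDPG k d)"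
    using assms by (simp add: DDPG_gdist_ends)
qed

lemma DDPG_row_diametral:
  assumes "1 \<le> i" "i \<le> k"
  shows "diametral_path (DDPG k d) (map (Pair i) [0..<Suc d])"
proof -
  have "vwalk (map (Pair i) [0..<Suc d]) (DDPG k d)"
    using assms by (intro vwalk_map_upt) (auto simp: DDPG_def DDPG_edges_def Let_def)
  then have "vpath (map (Pair i) [0..<Suc d]) (DDPG k d)"
    by (simp add: vpath_def distinct_map inj_on_def del: upt_Suc)
  moreover have "hd (map (Pair i) [0..<Suc d]) = (i, 0)" "last (map (Pair i) [0..<Suc d]) = (i, d)"
    by (auto simp: hd_map simp del: upt_Suc) (simp add: last_map)
  ultimately show ?thesis
    using assms by (simp add: diametral_path_def DDPG_gdist_ends DDPG_diameter del: upt_Suc)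
qed

end

theorem theorem10:
  fixes k d :: nat
  assumes "k \<ge> 1" and "d \<ge> 4"
  shows "\<exists>P :: (nat \<times> nat) vwalk set.
           card P = k \<and>
           (\<forall>p\<in>P. diametral_path (with_proj (DDPG k d)) p \<and> vwalk_length p = d) \<and>
           pairwise totally_disjoint P"
proof (intro exI conjI)
  \<comment> \<open>The bound is \<open>Suc d\<close> because a path of length \<open>d\<close> has
    \<open>d + 1\<close> vertices. These lists are therefore nonempty, so each determines its
    \<open>i\<close> and the \<open>k\<close> rows are distinct.\<close>
  let ?row = "\<lambda>i. map (Pair i) [0..<Suc d] :: (nat \<times> nat) list"
  have "inj_on ?row {1..k}"
    by (auto simp: inj_on_def simp del: upt_Suc)
  then show "card (?row ` {1..k}) = k"
    by (simp add: card_image)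
  show "\<forall>p\<in>?row ` {1..k}. diametral_path (DDPG k d) p \<and> vwalk_length p = d"
    using DDPG_row_diametral[OF assms(2)] by (auto simp del: upt_Suc)
  show "pairwise totally_disjoint (?row ` {1..k})"
    by (auto simp: pairwise_def totally_disjoint_def simp del: upt_Suc)
qed

end
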